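(* For $n \equiv 2 \pmod 3$, let $X^{sub}_n$ be the number of closed proper subterm occurrences of a closed linear $\lambda$-term of size $n$ drawn uniformly at random (terms taken up to $\alpha$-equivalence). Then, as $n\to\infty$ along $n \equiv 2 \pmod 3$, $X^{sub}_n$ converges in distribution to a Poisson random variable of rate $1$.
   Context: $\lambda$-terms are built from variables, applications $(t~u)$ and abstractions $\lambda x.t$. A term is linear if every free or bound variable is used exactly once, and closed if it has no free variables. Size is defined by $|x|=1$, $|(t~u)|=1+|t|+|u|$, $|\lambda x.t|=1+|t|$; closed linear terms exist only in sizes $n\equiv 2\pmod 3$. The subterms of $t$ are $t$ itself, the subterms of $t_1,t_2$ if $t=(t_1~t_2)$, and the subterms of $u$ if $t=\lambda x.u$. The proper subterms are all subterms except $t$ itself, and different occurrences are counted separately. A closed proper subterm is a proper subterm occurrence that is a closed term. Under the known bijection between closed linear terms and rooted trivalent maps, closed proper subterms correspond to internal bridges, i.e. bridges both of whose endpoints are trivalent vertices. *)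

theory Defs
  imports "HOL-Probability.Probability" "HOL-Library.Multiset"
begin

text \<open>
  Terms up to \<open>\<alpha>\<close>-equivalence, in de Bruijn notation: \<open>Var i\<close> under \<open>d\<close> abstractions is
  bound by the \<open>i\<close>-th enclosing one (counted outwards from 0) if \<open>i < d\<close>, and otherwise
  is an occurrence of the free variable \<open>i - d\<close>.
\<close>

datatype tm = Var nat | App tm tm | Lam tm

fun tm_size :: "tm \<Rightarrow> nat" where
  "tm_size (Var i) = 1"
| "tm_size (App t u) = 1 + tm_size t + tm_size u"
| "tm_size (Lam t) = 1 + tm_size t"

text \<open>Number of occurrences of the free variable \<open>k\<close>.\<close>

fun occs :: "nat \<Rightarrow> tm \<Rightarrow> nat" where
  "occs k (Var i) = (if i = k then 1 else 0)"
| "occs k (App t u) = occs k t + occs k u"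
| "occs k (Lam t) = occs (Suc k) t"

definition free_vars :: "tm \<Rightarrow> nat set" where
  "free_vars t = {k. occs k t \<noteq> 0}"

definition closed_term :: "tm \<Rightarrow> bool" where
  "closed_term t \<longleftrightarrow> free_vars t = {}"

fun bound_once :: "tm \<Rightarrow> bool" where
  "bound_once (Var i) \<longleftrightarrow> True"
| "bound_once (App t u) \<longleftrightarrow> bound_once t \<and> bound_once u"
| "bound_once (Lam t) \<longleftrightarrow> occs 0 t = 1 \<and> bound_once t"

definition linear_term :: "tm \<Rightarrow> bool" where
  "linear_term t \<longleftrightarrow> (\<forall>k \<in> free_vars t. occs k t = 1) \<and> bound_once t"

text \<open>
  Multisets, because different occurrences of a subterm are counted separately. The body of
  an abstraction keeps its indices, so a subterm using a variable bound outside it is not closed.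
\<close>

fun subterms :: "tm \<Rightarrow> tm multiset" where
  "subterms (Var i) = {#Var i#}"
| "subterms (App t u) = {#App t u#} + subterms t + subterms u"
| "subterms (Lam t) = {#Lam t#} + subterms t"

definition proper_subterms :: "tm \<Rightarrow> tm multiset" where
  "proper_subterms t = subterms t - {#t#}"

definition closed_proper_subterm_count :: "tm \<Rightarrow> nat" where
  "closed_proper_subterm_count t = size (filter_mset closed_term (proper_subterms t))"

definition closed_linear_terms :: "nat \<Rightarrow> tm set" where
  "closed_linear_terms n = {t. closed_term t \<and> linear_term t \<and> tm_size t = n}"

definition X_sub_law :: "nat \<Rightarrow> real measure" where
  "X_sub_law n = distr (measure_pmf (pmf_of_set (closed_linear_terms n))) borel
               (\<lambda>t. real (closed_proper_subterm_count t))"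

text \<open>
  \<open>pmf_of_set\<close> is the uniform distribution only on finite nonempty sets.
\<close>

lemma finite_bounded_terms: "finite {t. tm_size t \<le> n \<and> (\<forall>k\<ge>m. occs k t = 0)}"
proof (induction n arbitrary: m)
  case 0
  have "tm_size t > 0" for t by (cases t) auto
  then have "{t. tm_size t \<le> 0 \<and> (\<forall>k\<ge>m. occs k t = 0)} = {}"
    by (metis (mono_tags, lifting) Collect_empty_eq leD)
  then show ?case by (simp only: finite.emptyI)
next
  case (Suc n)
  let ?S = "\<lambda>m. {t. tm_size t \<le> n \<and> (\<forall>k\<ge>m. occs k t = 0)}"
  have "{t. tm_size t \<le> Suc n \<and> (\<forall>k\<ge>m. occs k t = 0)}
      \<subseteq> Var ` {..<m} \<union> (\<lambda>(t, u). App t u) ` (?S m \<times> ?S m) \<union> Lam ` ?S (Suc m)"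
  proof
    fix t assume t: "t \<in> {t. tm_size t \<le> Suc n \<and> (\<forall>k\<ge>m. occs k t = 0)}"
    show "t \<in> Var ` {..<m} \<union> (\<lambda>(t, u). App t u) ` (?S m \<times> ?S m) \<union> Lam ` ?S (Suc m)"
    proof (cases t)
      case (Var i)
      with t have "i < m" by (auto simp: not_le[symmetric])
      with Var show ?thesis by auto
    next
      case (App u v)
      with t show ?thesis by auto
    next
      case (Lam u)
      with t have "tm_size u \<le> n" "\<forall>k\<ge>Suc m. occs k u = 0"
        by (auto simp: Suc_le_eq dest!: less_imp_Suc_add)
      with Lam show ?thesis by auto
    qed
  qed
  moreover have "finite (Var ` {..<m} \<union> (\<lambda>(t, u). App t u) ` (?S m \<times> ?S m) \<union> Lam ` ?S (Suc m))"
    using Suc.IH by blast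
  ultimately show ?case by (rule finite_subset)
qed

lemma finite_closed_linear_terms: "finite (closed_linear_terms n)"
  by (rule finite_subset[OF _ finite_bounded_terms[of n 0]])
     (auto simp: closed_linear_terms_def closed_term_def free_vars_def)

lemma closed_linear_terms_nonempty:
  assumes "n mod 3 = 2"
  shows "closed_linear_terms n \<noteq> {}"
proof -
  have "\<exists>t. t \<in> closed_linear_terms (3 * k + 2)" for k
  proof (induction k)
    case 0
    have "Lam (Var 0) \<in> closed_linear_terms (3 * 0 + 2)"
      by (simp add: closed_linear_terms_def closed_term_def linear_term_def free_vars_def)
    then show ?case ..
  next
    case (Suc k)
    then obtain t where "t \<in> closed_linear_terms (3 * k + 2)" ..
    then have "App (Lam (Var 0)) t \<in> closed_linear_terms (3 * Suc k + 2)"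
      by (simp add: closed_linear_terms_def closed_term_def linear_term_def free_vars_def)
    then show ?case ..
  qed
  moreover have "n = 3 * (n div 3) + 2" using assms by presburger
  ultimately show ?thesis by (metis empty_iff)
qed

end

theory Submission
  imports Defs "HOL-Real_Asymp.Real_Asymp"
begin

text \<open>
  Let \<open>l(n, r)\<close> count the linear terms of size \<open>n\<close> with \<open>r\<close> labelled free variables. Almost all closed
  proper subterms are copies of the identity \<open>\<lambda>x. x\<close>. Replacing \<open>s\<close> marked copies by free variables
  shows that the \<open>s\<close>-th factorial moment of their number is \<open>l(n - s, s) / l(n, 0)\<close>. Contracting the
  application that introduces a free variable gives \<open>l(n + 2, r + 1) = 2 n l(n, r)\<close>, while \<open>l(n + 3, 0)\<close>
  exceeds \<open>l(n + 2, 1)\<close> only by a convolution that is \<open>O(l(n, 0))\<close>. So every factorial moment is at most 1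
  and tends to 1, and the characteristic functions converge by Tannery's theorem. The expected number
  of closed proper subterms other than the identity is bounded by the inner part of the same
  convolution, divided by \<open>l(n, 0)\<close>, and tends to 0.
\<close>

subsection \<open>Enumeration by free variables and identity subterms\<close>

text \<open>Arbitrary finite sets of labels occur, not only initial segments, because an application
  distributes its free variables over two complementary subsets.\<close>

definition lin_terms :: "nat set \<Rightarrow> nat \<Rightarrow> tm set" where
  "lin_terms S n = {t. tm_size t = n \<and> bound_once t \<and> (\<forall>k. occs k t = (if k \<in> S then 1 else 0))}"

lemma lin_terms_empty_eq: "lin_terms {} n = closed_linear_terms n"
  by (auto simp: lin_terms_def closed_linear_terms_def linear_term_def closed_term_def free_vars_def)

lemma finite_lin_terms [simp]:
  assumes "finite S"
  shows "finite (lin_terms S n)"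
proof -
  obtain m where "S \<subseteq> {..<m}"
    using assms finite_nat_bounded by blast
  then show ?thesis
    by (intro finite_subset[OF _ finite_bounded_terms[of n m]]) (auto simp: lin_terms_def)
qed

lemma tm_size_pos: "tm_size t > 0"
  by (cases t) auto

lemma lin_terms_0 [simp]: "lin_terms S 0 = {}"
  using tm_size_pos by (auto simp: lin_terms_def)

lemma Var_in_lin_terms: "Var i \<in> lin_terms S n \<longleftrightarrow> n = 1 \<and> S = {i}"
  by (fastforce simp: lin_terms_def split: if_splits)

lemma Lam_in_lin_terms: "Lam t \<in> lin_terms S (Suc n) \<longleftrightarrow> t \<in> lin_terms (insert 0 (Suc ` S)) n"
proof -
  have split: "(\<forall>k. P k) \<longleftrightarrow> P 0 \<and> (\<forall>k. P (Suc k))" for P :: "nat \<Rightarrow> bool"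
    by (metis nat.exhaust)
  have "(\<forall>k. occs k t = (if k \<in> insert 0 (Suc ` S) then 1 else 0)) \<longleftrightarrow>
        occs 0 t = 1 \<and> (\<forall>k. occs (Suc k) t = (if k \<in> S then 1 else 0))"
    by (subst split) (simp add: image_iff)
  then show ?thesis
    by (auto simp: lin_terms_def)
qed

text \<open>Linearity sends each free variable to exactly one side, so the variables of the left
  argument form the set \<open>A\<close> and those of the right argument its complement in
  \<open>S\<close>.\<close>

lemma App_in_lin_terms:
  "App t u \<in> lin_terms S (Suc n) \<longleftrightarrow>
    (\<exists>m\<le>n. \<exists>A\<subseteq>S. t \<in> lin_terms A m \<and> u \<in> lin_terms (S - A) (n - m))"
proof
  assume *: "App t u \<in> lin_terms S (Suc n)"
  have occs: "occs k t + occs k u = (if k \<in> S then 1 else 0)" for k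
    using * by (simp add: lin_terms_def)
  define A where "A = {k. occs k t \<noteq> 0}"
  have "A \<subseteq> S"
    using occs unfolding A_def by (metis (mono_tags, lifting) add_is_0 mem_Collect_eq subsetI)
  moreover have "occs k t = (if k \<in> A then 1 else 0)" "occs k u = (if k \<in> S - A then 1 else 0)" for k
    using occs[of k] by (auto simp: A_def split: if_splits)
  ultimately have "tm_size t \<le> n \<and> A \<subseteq> S \<and> t \<in> lin_terms A (tm_size t) \<and> u \<in> lin_terms (S - A) (n - tm_size t)"
    using * by (auto simp: lin_terms_def)
  then show "\<exists>m\<le>n. \<exists>A\<subseteq>S. t \<in> lin_terms A m \<and> u \<in> lin_terms (S - A) (n - m)"
    by blast
next
  assume "\<exists>m\<le>n. \<exists>A\<subseteq>S. t \<in> lin_terms A m \<and> u \<in> lin_terms (S - A) (n - m)"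
  then show "App t u \<in> lin_terms S (Suc n)"
    by (auto simp: lin_terms_def split: if_splits)
qed

text \<open>Makes the decomposition of an application into \<open>m\<close>, \<open>A\<close> and
  its two arguments unique.\<close>

lemma lin_terms_disjoint:
  "t \<in> lin_terms A m \<Longrightarrow> t \<in> lin_terms B n \<Longrightarrow> A = B \<and> m = n"
  unfolding lin_terms_def by (auto simp: set_eq_iff) (metis zero_neq_one)+

text \<open>Decomposition at the root. The weighted counts and the totals of subterm statistics
  below all come from it by a choice of \<open>f\<close>. The first sum ranges over at most one
  index.\<close>

lemma sum_lin_terms_Suc:
  fixes f :: "tm \<Rightarrow> 'a::comm_monoid_add"
  assumes "finite S"
  shows "sum f (lin_terms S (Suc n)) =
    (\<Sum>i\<in>{i. n = 0 \<and> S = {i}}. f (Var i)) +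
    (\<Sum>m\<le>n. \<Sum>A\<in>Pow S. \<Sum>t\<in>lin_terms A m. \<Sum>u\<in>lin_terms (S - A) (n - m). f (App t u)) +
    (\<Sum>t\<in>lin_terms (insert 0 (Suc ` S)) n. f (Lam t))"
proof -
  let ?V = "{i. n = 0 \<and> S = {i}}"
  let ?T = "\<lambda>(m, A). lin_terms A m \<times> lin_terms (S - A) (n - m)"
  let ?P = "Sigma ({..n} \<times> Pow S) ?T"
  let ?L = "lin_terms (insert 0 (Suc ` S)) n"
  let ?app = "\<lambda>(_, t, u). App t u"
  have fin: "finite A" if "A \<in> Pow S" for A
    using that assms finite_subset by blast
  have finV: "finite ?V"
    by (rule finite_subset[of _ S]) (auto simp: assms)
  have finP: "finite ?P"
    using assms fin by (intro finite_SigmaI) auto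
  have finL: "finite ?L"
    using assms by simp
  have eq: "lin_terms S (Suc n) = Var ` ?V \<union> ?app ` ?P \<union> Lam ` ?L"
  proof (intro set_eqI)
    fix t
    show "t \<in> lin_terms S (Suc n) \<longleftrightarrow> t \<in> Var ` ?V \<union> ?app ` ?P \<union> Lam ` ?L"
    proof (cases t)
      case (Var i)
      then show ?thesis by (auto simp: Var_in_lin_terms)
    next
      case (App u v)
      have "t \<in> Var ` ?V \<union> ?app ` ?P \<union> Lam ` ?L \<longleftrightarrow> App u v \<in> ?app ` ?P"
        unfolding App by blast
      also have "\<dots> \<longleftrightarrow> (\<exists>m\<le>n. \<exists>A\<subseteq>S. u \<in> lin_terms A m \<and> v \<in> lin_terms (S - A) (n - m))"
      proof
        assume "App u v \<in> ?app ` ?P"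
        then show "\<exists>m\<le>n. \<exists>A\<subseteq>S. u \<in> lin_terms A m \<and> v \<in> lin_terms (S - A) (n - m)"
          by (elim imageE SigmaE) auto
      next
        assume "\<exists>m\<le>n. \<exists>A\<subseteq>S. u \<in> lin_terms A m \<and> v \<in> lin_terms (S - A) (n - m)"
        then obtain m A where "((m, A), u, v) \<in> ?P"
          by auto
        then have "?app ((m, A), u, v) \<in> ?app ` ?P"
          by (rule imageI)
        then show "App u v \<in> ?app ` ?P"
          by simp
      qed
      finally show ?thesis
        using App App_in_lin_terms by simp
    next
      case (Lam u)
      then show ?thesis by (auto simp: Lam_in_lin_terms)
    qed
  qed
  have injP: "inj_on ?app ?P"
    using lin_terms_disjoint by (auto simp: inj_on_def)
  have "sum f (lin_terms S (Suc n)) = sum f (Var ` ?V) + sum f (?app ` ?P) + sum f (Lam ` ?L)"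
    unfolding eq using finV finP finL
    by (subst sum.union_disjoint, force, force, force)+ simp
  also have "sum f (Var ` ?V) = (\<Sum>i\<in>?V. f (Var i))"
    by (subst sum.reindex) (auto simp: inj_on_def)
  also have "sum f (Lam ` ?L) = (\<Sum>t\<in>?L. f (Lam t))"
    by (subst sum.reindex) (auto simp: inj_on_def)
  also have "sum f (?app ` ?P) = (\<Sum>p\<in>?P. f (?app p))"
    by (subst sum.reindex[OF injP]) (simp add: o_def)
  also have "\<dots> = (\<Sum>q\<in>{..n} \<times> Pow S. \<Sum>p\<in>?T q. f (App (fst p) (snd p)))"
    using assms fin by (subst sum.Sigma) (auto simp: case_prod_unfold)
  also have "\<dots> = (\<Sum>q\<in>{..n} \<times> Pow S. \<Sum>t\<in>lin_terms (snd q) (fst q).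
      \<Sum>u\<in>lin_terms (S - snd q) (n - fst q). f (App t u))"
    by (simp add: case_prod_unfold sum.cartesian_product)
  also have "\<dots> = (\<Sum>m\<le>n. \<Sum>A\<in>Pow S. \<Sum>t\<in>lin_terms A m. \<Sum>u\<in>lin_terms (S - A) (n - m). f (App t u))"
    by (simp add: sum.cartesian_product case_prod_unfold)
  finally show ?thesis .
qed

section \<open>Binomial convolution\<close>

text \<open>
  The product of exponential generating functions in terms of coefficients; the recursion is the
  product rule, since \<open>\<lambda>i. f (Suc i)\<close> is the derivative.
\<close>

fun binconv :: "(nat \<Rightarrow> 'a) \<Rightarrow> (nat \<Rightarrow> 'a) \<Rightarrow> nat \<Rightarrow> 'a::comm_ring_1" where
  "binconv f g 0 = f 0 * g 0"
| "binconv f g (Suc r) = binconv (\<lambda>i. f (Suc i)) g r + binconv f (\<lambda>i. g (Suc i)) r"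

text \<open>The subsets of \<open>insert x S\<close> without \<open>x\<close> and those with
  \<open>x\<close> give the two terms of the recursion of \<open>binconv\<close>.\<close>

lemma sum_Pow_eq_binconv:
  assumes "finite S"
  shows "(\<Sum>A\<in>Pow S. f (card A) * g (card (S - A))) = binconv f g (card S)"
  using assms
proof (induction S arbitrary: f g rule: finite_induct)
  case (insert x S)
  have fin: "finite A" "x \<notin> A" if "A \<subseteq> S" for A
    using that insert.hyps finite_subset by blast+
  have disj: "Pow S \<inter> insert x ` Pow S = {}"
    using insert.hyps by auto
  have inj: "inj_on (insert x) (Pow S)"
    using insert.hyps by (auto simp: inj_on_def)
  have "(\<Sum>A\<in>Pow (insert x S). f (card A) * g (card (insert x S - A))) =
     (\<Sum>A\<in>Pow S. f (card A) * g (card (insert x S - A))) +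
     (\<Sum>A\<in>Pow S. f (card (insert x A)) * g (card (insert x S - insert x A)))"
    using insert.hyps disj inj
    by (simp add: Pow_insert sum.union_disjoint sum.reindex)
  also have "(\<Sum>A\<in>Pow S. f (card A) * g (card (insert x S - A))) =
      (\<Sum>A\<in>Pow S. f (card A) * g (Suc (card (S - A))))"
    using insert.hyps fin by (intro sum.cong) (auto simp: insert_Diff_if)
  also have "(\<Sum>A\<in>Pow S. f (card (insert x A)) * g (card (insert x S - insert x A))) =
      (\<Sum>A\<in>Pow S. f (Suc (card A)) * g (card (S - A)))"
    using insert.hyps fin by (intro sum.cong) (auto simp: insert_Diff_if)
  finally show ?case
    using insert.hyps insert.IH[of "\<lambda>i. f (Suc i)" g] insert.IH[of f "\<lambda>i. g (Suc i)"]
    by simp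
qed simp

lemma binconv_commute: "binconv f g r = binconv g f r"
  by (induction r arbitrary: f g) (simp_all add: mult.commute)

lemma binconv_add_right: "binconv f (\<lambda>i. g i + h i) r = binconv f g r + binconv f h r"
  by (induction r arbitrary: f g h) (simp_all add: algebra_simps)

lemma binconv_cmult_right: "binconv f (\<lambda>i. c * g i) r = c * binconv f g r"
  by (induction r arbitrary: f g) (simp_all add: algebra_simps)

lemma binconv_zero_right [simp]: "binconv f (\<lambda>i. 0) r = 0"
  by (induction r arbitrary: f) simp_all

lemma binconv_zero_left [simp]: "binconv (\<lambda>i. 0) f r = 0"
  by (simp add: binconv_commute[of _ f])

lemma binconv_sum_right: "binconv f (\<lambda>i. \<Sum>x\<in>A. g x i) r = (\<Sum>x\<in>A. binconv f (g x) r)"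
  by (induction A rule: infinite_finite_induct) (simp_all add: binconv_add_right)

lemma pderiv_sum: "pderiv (\<Sum>x\<in>A. f x) = (\<Sum>x\<in>A. pderiv (f x))"
  by (induction A rule: infinite_finite_induct) (simp_all add: pderiv_add)

lemma pderiv_binconv:
  "pderiv (binconv f g r) = binconv (\<lambda>i. pderiv (f i)) g r + binconv f (\<lambda>i. pderiv (g i)) r"
  by (induction r arbitrary: f g) (simp_all add: pderiv_add pderiv_mult algebra_simps)

section \<open>Enumeration weighted by identity subterms\<close>

fun id_count :: "tm \<Rightarrow> nat" where
  "id_count (Var i) = 0"
| "id_count (App t u) = id_count t + id_count u"
| "id_count (Lam t) = id_count t + (if t = Var 0 then 1 else 0)"

text \<open>The weight may lie in any commutative ring: \<open>1\<close> gives plain counts, and the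
  polynomial \<open>[:1, 1:]\<close> lets each identity subterm be marked or not, so that its
  coefficients are unnormalized factorial moments divided by factorials.\<close>

definition id_enum :: "'a \<Rightarrow> nat \<Rightarrow> nat \<Rightarrow> 'a::comm_ring_1" where
  "id_enum w n r = (\<Sum>t\<in>lin_terms {..<r} n. w ^ id_count t)"

text \<open>That a weighted sum depends only on the number of labels is a hypothesis here, so that
  the same statement serves as induction step for this fact and later as the recurrence
  \<open>id_enum_Suc\<close>. The term \<open>w - 1\<close> corrects the abstraction case: the body
  of \<open>Lam (Var 0)\<close> has weight 1, the identity itself weight \<open>w\<close>.\<close>

lemma sum_id_weight_Suc:
  assumes S: "finite S"
    and IH: "\<And>m A. m \<le> n \<Longrightarrow> finite A \<Longrightarrow> (\<Sum>t\<in>lin_terms A m. w ^ id_count t) = id_enum w m (card A)"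
  shows "(\<Sum>t\<in>lin_terms S (Suc n). w ^ id_count t) =
    (if n = 0 \<and> card S = 1 then 1 else 0) + (if n = 1 \<and> card S = 0 then w - 1 else 0) +
    (\<Sum>m\<le>n. binconv (id_enum w m) (id_enum w (n - m)) (card S)) + id_enum w n (Suc (card S))"
proof -
  have "(\<Sum>i\<in>{i. n = 0 \<and> S = {i}}. w ^ id_count (Var i)) = (if n = 0 \<and> card S = 1 then 1 else 0)"
  proof (cases "\<exists>j. S = {j}")
    case True
    then obtain j where "S = {j}" ..
    then have "{i. n = 0 \<and> S = {i}} = (if n = 0 then {j} else {})"
      by auto
    then show ?thesis
      using \<open>S = {j}\<close> by simp
  next
    case False
    then show ?thesis
      by (auto simp: card_1_singleton_iff)
  qed
  moreover have "(\<Sum>m\<le>n. \<Sum>A\<in>Pow S. \<Sum>t\<in>lin_terms A m. \<Sum>u\<in>lin_terms (S - A) (n - m). w ^ id_count (App t u)) =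
     (\<Sum>m\<le>n. binconv (id_enum w m) (id_enum w (n - m)) (card S))"
  proof (rule sum.cong[OF refl])
    fix m assume "m \<in> {..n}"
    have "(\<Sum>A\<in>Pow S. \<Sum>t\<in>lin_terms A m. \<Sum>u\<in>lin_terms (S - A) (n - m). w ^ id_count (App t u)) =
       (\<Sum>A\<in>Pow S. (\<Sum>t\<in>lin_terms A m. w ^ id_count t) * (\<Sum>u\<in>lin_terms (S - A) (n - m). w ^ id_count u))"
      by (simp add: sum_product power_add)
    also have "\<dots> = (\<Sum>A\<in>Pow S. id_enum w m (card A) * id_enum w (n - m) (card (S - A)))"
      using \<open>m \<in> {..n}\<close> S by (intro sum.cong refl arg_cong2[where f = "(*)"] IH) (auto intro: finite_subset)
    finally show "(\<Sum>A\<in>Pow S. \<Sum>t\<in>lin_terms A m. \<Sum>u\<in>lin_terms (S - A) (n - m). w ^ id_count (App t u)) =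
       binconv (id_enum w m) (id_enum w (n - m)) (card S)"
      using sum_Pow_eq_binconv[OF S] by metis
  qed
  moreover have "(\<Sum>t\<in>lin_terms (insert 0 (Suc ` S)) n. w ^ id_count (Lam t)) =
      id_enum w n (Suc (card S)) + (if n = 1 \<and> card S = 0 then w - 1 else 0)"
  proof -
    let ?L = "lin_terms (insert 0 (Suc ` S)) n"
    have "(\<Sum>t\<in>?L. w ^ id_count (Lam t)) = (\<Sum>t\<in>?L. w ^ id_count t + (if t = Var 0 then w - 1 else 0))"
      by (intro sum.cong) auto
    also have "\<dots> = (\<Sum>t\<in>?L. w ^ id_count t) + (if Var 0 \<in> ?L then w - 1 else 0)"
      using S by (simp add: sum.distrib)
    also have "(\<Sum>t\<in>?L. w ^ id_count t) = id_enum w n (card (insert 0 (Suc ` S)))"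
      using S by (intro IH) auto
    also have "card (insert 0 (Suc ` S)) = Suc (card S)"
      using S by (simp add: card_image)
    also have "Var 0 \<in> ?L \<longleftrightarrow> n = 1 \<and> card S = 0"
      using S by (auto simp: Var_in_lin_terms)
    finally show ?thesis .
  qed
  ultimately show ?thesis
    by (simp only: sum_lin_terms_Suc[OF S]) (simp add: algebra_simps)
qed

text \<open>Instead of a renaming bijection, the recurrence is applied both to \<open>S\<close> and
  to the initial segment of the same cardinality; the right-hand sides agree.\<close>

lemma sum_id_weight_eq:
  "finite S \<Longrightarrow> (\<Sum>t\<in>lin_terms S n. w ^ id_count t) = id_enum w n (card S)"
proof (induction n arbitrary: S rule: less_induct)
  case (less n)
  show ?case
  proof (cases n)
    case 0
    then show ?thesis by (simp add: id_enum_def)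
  next
    case (Suc k)
    have IH: "(\<Sum>t\<in>lin_terms A m. w ^ id_count t) = id_enum w m (card A)"
      if "m \<le> k" "finite A" for m A
      using that Suc less.IH by simp
    show ?thesis
      unfolding Suc id_enum_def
      by (simp only: sum_id_weight_Suc[OF less.prems IH] sum_id_weight_Suc[OF finite_lessThan IH]
          card_lessThan)
  qed
qed

lemma id_enum_0 [simp]: "id_enum w 0 = (\<lambda>r. 0)"
  by (simp add: id_enum_def fun_eq_iff)

lemma id_enum_Suc:
  "id_enum w (Suc n) r =
    (if n = 0 \<and> r = 1 then 1 else 0) + (if n = 1 \<and> r = 0 then w - 1 else 0) +
    (\<Sum>m\<le>n. binconv (id_enum w m) (id_enum w (n - m)) r) + id_enum w n (Suc r)"
  unfolding id_enum_def[of w "Suc n"]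
  by (subst sum_id_weight_Suc[OF _ sum_id_weight_eq]) simp_all

text \<open>
  Replacing a marked identity by a fresh free variable lowers the size by one.
\<close>

lemma pderiv_id_enum_Suc:
  "pderiv (id_enum [:1, 1:] (Suc n) r :: 'a::idom poly) = id_enum [:1, 1:] n (Suc r)"
proof (induction n arbitrary: r rule: less_induct)
  case (less n)
  let ?p = "id_enum [:1, 1:] :: nat \<Rightarrow> nat \<Rightarrow> 'a poly"
  show ?case
  proof (cases n)
    case 0
    then show ?thesis
      by (simp add: id_enum_Suc)
  next
    case (Suc k)
    have IH: "pderiv (?p (Suc m) r) = ?p m (Suc r)" if "m \<le> k" for m r
      using that Suc less.IH[of m] by simp
    have "pderiv (\<Sum>m\<le>Suc k. binconv (?p m) (?p (Suc k - m)) r) =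
        (\<Sum>m\<le>Suc k. binconv (\<lambda>i. pderiv (?p m i)) (?p (Suc k - m)) r) +
        (\<Sum>m\<le>Suc k. binconv (?p m) (\<lambda>i. pderiv (?p (Suc k - m) i)) r)"
      by (simp only: pderiv_sum pderiv_binconv sum.distrib)
    \<comment> \<open>The summand \<open>m = 0\<close> vanishes since no term has size 0; in the
      other sum the same happens at \<open>m = Suc k\<close>. The remaining sizes are positive, as
      the induction hypothesis requires.\<close>
    also have "(\<Sum>m\<le>Suc k. binconv (\<lambda>i. pderiv (?p m i)) (?p (Suc k - m)) r) =
        (\<Sum>m\<le>k. binconv (\<lambda>i. ?p m (Suc i)) (?p (k - m)) r)"
      by (simp add: sum.atMost_Suc_shift IH del: sum.atMost_Suc)
    also have "(\<Sum>m\<le>Suc k. binconv (?p m) (\<lambda>i. pderiv (?p (Suc k - m) i)) r) =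
        (\<Sum>m\<le>k. binconv (?p m) (\<lambda>i. ?p (k - m) (Suc i)) r)"
      by (simp add: IH Suc_diff_le)
    also have "(\<Sum>m\<le>k. binconv (\<lambda>i. ?p m (Suc i)) (?p (k - m)) r) + \<dots> =
        (\<Sum>m\<le>k. binconv (?p m) (?p (k - m)) (Suc r))"
      by (simp add: sum.distrib)
    finally have *: "pderiv (\<Sum>m\<le>Suc k. binconv (?p m) (?p (Suc k - m)) r) =
        (\<Sum>m\<le>k. binconv (?p m) (?p (k - m)) (Suc r))" .
    \<comment> \<open>The correction \<open>w - 1\<close> has derivative 1 and becomes the base term
      of the recurrence for \<open>?p (Suc k) (Suc r)\<close>: the identity of size 2 turns into a
      variable of size 1.\<close>
    have "pderiv (?p (Suc n) r) = (if k = 0 \<and> r = 0 then 1 else 0) +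
        (\<Sum>m\<le>k. binconv (?p m) (?p (k - m)) (Suc r)) + pderiv (?p (Suc k) (Suc r))"
      unfolding Suc id_enum_Suc[of _ "Suc k" r] pderiv_add *
      by (simp add: pderiv_diff pderiv_pCons one_pCons)
    also have "\<dots> = ?p (Suc k) (Suc r)"
      unfolding IH[OF order_refl] unfolding id_enum_Suc[of _ k "Suc r"] by simp
    finally show ?thesis
      using Suc by simp
  qed
qed

text \<open>Iterated differentiation turns \<open>s\<close> marked identities into \<open>s\<close>
  labelled variables; \<open>fact s\<close> forgets the order of the labels. At argument 0 the
  weight \<open>[:1, 1:]\<close> is 1.\<close>

lemma coeff_id_enum:
  "coeff (id_enum [:1, 1:] n r :: 'a::field_char_0 poly) s =
    (if s \<le> n then id_enum 1 (n - s) (r + s) / fact s else 0)"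
proof (induction s arbitrary: n r)
  case 0
  have "poly (id_enum [:1, 1:] n r) 0 = (id_enum 1 n r :: 'a)"
    by (simp add: id_enum_def poly_sum)
  then show ?case
    by (simp add: poly_0_coeff_0)
next
  case (Suc s)
  show ?case
  proof (cases n)
    case 0
    then show ?thesis by simp
  next
    case (Suc k)
    have "coeff (id_enum [:1, 1:] n r) (Suc s) * of_nat (Suc s) = coeff (id_enum [:1, 1:] k (Suc r) :: 'a poly) s"
      unfolding Suc pderiv_id_enum_Suc[symmetric] coeff_pderiv by (rule mult.commute)
    also have "\<dots> = (if s \<le> k then id_enum 1 (k - s) (Suc r + s) / fact s else 0)"
      by (rule Suc.IH)
    finally have "coeff (id_enum [:1, 1:] n r) (Suc s) =
        (if s \<le> k then id_enum 1 (k - s) (Suc r + s) / fact s else 0) / (of_nat (Suc s) :: 'a)"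
      by (subst nonzero_eq_divide_eq) (simp_all only: of_nat_neq_0 not_False_eq_True)
    then show ?thesis
      using Suc by (simp add: mult.commute)
  qed
qed

text \<open>The unnormalized probability generating function of \<open>id_count\<close>, expanded
  about 1: the coefficients are factorial moments over factorials.\<close>

lemma sum_id_weight_expand:
  fixes v :: "'a::field_char_0"
  shows "(\<Sum>t\<in>lin_terms {} n. (1 + v) ^ id_count t) = (\<Sum>s\<le>n. id_enum 1 (n - s) s / fact s * v ^ s)"
proof -
  let ?p = "id_enum [:1, 1:] n 0 :: 'a poly"
  have "(\<Sum>t\<in>lin_terms {} n. (1 + v) ^ id_count t) = poly ?p v"
    by (simp add: id_enum_def poly_sum)
  also have "\<dots> = (\<Sum>s\<le>n. coeff ?p s * v ^ s)"
  proof -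
    have "degree ?p \<le> n"
      by (rule degree_le) (simp add: coeff_id_enum)
    then show ?thesis
      unfolding poly_altdef by (intro sum.mono_neutral_left) (auto simp: coeff_eq_0)
  qed
  finally show ?thesis
    by (simp add: coeff_id_enum)
qed

subsection \<open>Unweighted counts\<close>

lemma binconv_unit: "binconv f (\<lambda>i. if i = 0 then 1 else 0) r = f r"
  by (induction r arbitrary: f) simp_all

lemma binconv_nonzero:
  assumes "binconv f g r \<noteq> 0"
  obtains i where "i \<le> r" "f i \<noteq> 0" "g (r - i) \<noteq> 0"
proof -
  have "\<exists>i\<le>r. f i \<noteq> 0 \<and> g (r - i) \<noteq> 0"
    using assms
  proof (induction r arbitrary: f g)
    case (Suc r)
    consider "binconv (\<lambda>i. f (Suc i)) g r \<noteq> 0" | "binconv f (\<lambda>i. g (Suc i)) r \<noteq> 0"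
      using Suc.prems by fastforce
    then show ?case
    proof cases
      case 1
      from Suc.IH[OF this] obtain i where "i \<le> r" "f (Suc i) \<noteq> 0" "g (r - i) \<noteq> 0"
        by blast
      then show ?thesis
        by (intro exI[of _ "Suc i"]) simp
    next
      case 2
      from Suc.IH[OF this] obtain i where "i \<le> r" "f i \<noteq> 0" "g (Suc (r - i)) \<noteq> 0"
        by blast
      then show ?thesis
        by (intro exI[of _ i]) (simp add: Suc_diff_le)
    qed
  qed (use mult_not_zero in auto)
  with that show ?thesis by blast
qed

lemma sum_atMost_rev:
  fixes f :: "nat \<Rightarrow> 'a::comm_monoid_add"
  shows "(\<Sum>i\<le>n. f (n - i)) = (\<Sum>i\<le>n. f i)"
  by (rule sum.reindex_bij_witness[of _ "\<lambda>i. n - i" "\<lambda>i. n - i"]) auto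

lemma sum_binconv_commute:
  fixes f g :: "nat \<Rightarrow> nat \<Rightarrow> 'a::comm_ring_1"
  shows "(\<Sum>m\<le>n. binconv (f m) (g (n - m)) r) = (\<Sum>m\<le>n. binconv (g m) (f (n - m)) r)"
proof -
  have "(\<Sum>m\<le>n. binconv (f m) (g (n - m)) r) = (\<Sum>m\<le>n. binconv (f (n - m)) (g (n - (n - m))) r)"
    by (rule sum_atMost_rev[of "\<lambda>m. binconv (f m) (g (n - m)) r", symmetric])
  also have "\<dots> = (\<Sum>m\<le>n. binconv (g m) (f (n - m)) r)"
    by (intro sum.cong) (auto simp: binconv_commute[of "g _"])
  finally show ?thesis .
qed

abbreviation lin_count :: "nat \<Rightarrow> nat \<Rightarrow> real" where
  "lin_count \<equiv> id_enum 1"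

lemma lin_count_eq_card: "lin_count n r = real (card (lin_terms {..<r} n))"
  by (simp add: id_enum_def)

lemma lin_count_nonneg [simp]: "lin_count n r \<ge> 0"
  by (simp add: lin_count_eq_card)

lemma card_lin_terms:
  "finite S \<Longrightarrow> real (card (lin_terms S n)) = lin_count n (card S)"
  using sum_id_weight_eq[of S 1 n] by simp

lemma lin_count_Suc:
  "lin_count (Suc n) r = (if n = 0 \<and> r = 1 then 1 else 0) +
    (\<Sum>m\<le>n. binconv (lin_count m) (lin_count (n - m)) r) + lin_count n (Suc r)"
  by (simp add: id_enum_Suc)

lemma lin_count_1: "lin_count (Suc 0) r = (if r = 1 then 1 else 0)"
  by (simp add: lin_count_Suc)

text \<open>
  The extra free variable of a term of size \<open>n + 2\<close> is the left or right argument of an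
  application; contracting it leaves a term of size \<open>n\<close> with one of its \<open>n\<close> subterms marked.
\<close>

lemma lin_count_insert: "lin_count (Suc (Suc n)) (Suc r) = 2 * real n * lin_count n r"
proof (induction n arbitrary: r rule: less_induct)
  case (less n)
  show ?case
  proof (cases n)
    case 0
    then show ?thesis
      by (simp add: lin_count_Suc)
  next
    case (Suc k)
    let ?L = lin_count
    let ?B = "\<lambda>m. binconv (?L m) (?L (k - m)) r"
    have IH: "?L (Suc (Suc m)) (Suc r) = 2 * real m * ?L m r" if "m \<le> k" for m r
      using that Suc less.IH[of m] by simp
    \<comment> \<open>\<open>R\<close> collects the applications whose extra free variable lies in
      the right argument; by symmetry the left argument contributes \<open>R\<close> as
      well.\<close>
    define R where "R = (\<Sum>m\<le>Suc (Suc k). binconv (?L m) (\<lambda>i. ?L (Suc (Suc k) - m) (Suc i)) r)"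
    \<comment> \<open>At \<open>m = Suc k\<close> the right argument is the extra variable itself,
      which gives \<open>?L (Suc k) r\<close>; at \<open>m = Suc (Suc k)\<close> it would have size
      0.\<close>
    have "R = (\<Sum>m\<le>k. binconv (?L m) (\<lambda>i. ?L (Suc (Suc (k - m))) (Suc i)) r) + ?L (Suc k) r"
      by (simp add: R_def lin_count_1 binconv_unit Suc_diff_le)
    also have "(\<Sum>m\<le>k. binconv (?L m) (\<lambda>i. ?L (Suc (Suc (k - m))) (Suc i)) r) =
        (\<Sum>m\<le>k. real (k - m) * ?B m + real (k - m) * ?B m)"
      by (intro sum.cong) (simp_all add: IH binconv_cmult_right)
    also have "\<dots> = (\<Sum>m\<le>k. real (k - m) * ?B m) + (\<Sum>m\<le>k. real (k - m) * ?B m)"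
      by (simp only: sum.distrib)
    \<comment> \<open>\<open>?B\<close> is symmetric under exchanging \<open>m\<close> and
      \<open>k - m\<close>, so one copy can carry the weight \<open>m\<close> and the other
      \<open>k - m\<close>; the weights add up to the constant \<open>k\<close>.\<close>
    also have "(\<Sum>m\<le>k. real (k - m) * ?B m) = (\<Sum>m\<le>k. real m * ?B m)"
      by (subst sum_atMost_rev[symmetric]) (auto intro!: sum.cong simp: binconv_commute)
    also have "(\<Sum>m\<le>k. real m * ?B m) + (\<Sum>m\<le>k. real m * ?B m) =
        (\<Sum>m\<le>k. real m * ?B m) + (\<Sum>m\<le>k. real (k - m) * ?B m)"
      by (subst (4) sum_atMost_rev[symmetric]) (auto intro!: sum.cong simp: binconv_commute)
    also have "\<dots> = real k * (\<Sum>m\<le>k. ?B m)"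
      by (simp add: sum.distrib[symmetric] sum_distrib_left of_nat_diff algebra_simps)
    finally have R: "R = real k * (\<Sum>m\<le>k. ?B m) + ?L (Suc k) r" .
    have "?L (Suc (Suc n)) (Suc r) =
        (\<Sum>m\<le>Suc (Suc k). binconv (\<lambda>i. ?L m (Suc i)) (?L (Suc (Suc k) - m)) r) + R +
        ?L (Suc (Suc k)) (Suc (Suc r))"
      unfolding Suc lin_count_Suc[of "Suc (Suc k)"] R_def binconv.simps sum.distrib by simp
    also have "(\<Sum>m\<le>Suc (Suc k). binconv (\<lambda>i. ?L m (Suc i)) (?L (Suc (Suc k) - m)) r) = R"
      unfolding R_def by (rule sum_binconv_commute)
    also have "?L (Suc (Suc k)) (Suc (Suc r)) = 2 * real k * ?L k (Suc r)"
      by (rule IH) simp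
    also have "R + R + 2 * real k * ?L k (Suc r) =
        2 * ?L (Suc k) r + 2 * (real k * ((\<Sum>m\<le>k. ?B m) + ?L k (Suc r)))"
      unfolding R by (simp add: algebra_simps)
    also have "real k * ((\<Sum>m\<le>k. ?B m) + ?L k (Suc r)) = real k * ?L (Suc k) r"
      unfolding lin_count_Suc[of k] by simp
    finally show ?thesis
      using Suc by (simp add: algebra_simps)
  qed
qed

text \<open>Size plus number of free variables is 2 for a variable and is kept by an abstraction.
  For an application the two sums and the extra node give 2 + 2 + 1, again 2 modulo 3.\<close>

lemma lin_count_nonzero_mod3: "lin_count n r \<noteq> 0 \<Longrightarrow> (n + r) mod 3 = 2"
proof (induction n arbitrary: r rule: less_induct)
  case (less n)
  show ?case
  proof (cases n)
    case 0
    then show ?thesis using less.prems by simp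
  next
    case (Suc k)
    consider "k = 0 \<and> r = 1" | m where "m \<le> k" "binconv (lin_count m) (lin_count (k - m)) r \<noteq> 0"
      | "lin_count k (Suc r) \<noteq> 0"
    proof (rule ccontr)
      assume "\<not> thesis"
      then have zero: "\<not> (k = 0 \<and> r = 1)" "lin_count k (Suc r) = 0"
        "\<And>m. m \<le> k \<Longrightarrow> binconv (lin_count m) (lin_count (k - m)) r = 0"
        using that by blast+
      then have "lin_count n r = 0"
        unfolding Suc lin_count_Suc by (simp only: sum.neutral if_False atMost_iff Ball_def) simp
      then show False
        using less.prems by contradiction
    qed
    then show ?thesis
    proof cases
      case 1
      then show ?thesis using Suc by simp
    next
      case 2
      from 2(2) obtain i where i: "i \<le> r" "lin_count m i \<noteq> 0" "lin_count (k - m) (r - i) \<noteq> 0"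
        by (rule binconv_nonzero)
      have "(m + i) mod 3 = 2" "(k - m + (r - i)) mod 3 = 2"
        using less.IH[OF _ i(2)] less.IH[OF _ i(3)] 2(1) Suc by auto
      moreover have "n + r = Suc ((m + i) + (k - m + (r - i)))"
        using 2(1) i(1) Suc by simp
      moreover have "Suc (a + b) mod 3 = 2" if "a mod 3 = 2" "b mod 3 = 2" for a b :: nat
        using that by presburger
      ultimately show ?thesis
        by metis
    next
      case 3
      then show ?thesis
        using less.IH[of k "Suc r"] Suc by simp
    qed
  qed
qed

section \<open>Recurrence and bounds for the counts of closed terms\<close>

definition closed_count :: "nat \<Rightarrow> real" where
  "closed_count k = lin_count (3 * k + 2) 0"

lemma closed_count_eq_card: "closed_count k = real (card (closed_linear_terms (3 * k + 2)))"
  by (simp add: closed_count_def lin_count_eq_card lin_terms_empty_eq)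

lemma closed_count_0: "closed_count 0 = 1"
  by (simp add: closed_count_def lin_count_Suc numeral_2_eq_2)

text \<open>Since \<open>n mod 3 < 2\<close>, the last index up to \<open>n\<close> that is 2 modulo
  3 is \<open>3 * k + 2\<close>.\<close>

lemma sum_mod3_support:
  fixes f :: "nat \<Rightarrow> real"
  assumes "\<And>m. f m \<noteq> 0 \<Longrightarrow> m mod 3 = 2" and "n div 3 = Suc k" "n mod 3 < 2"
  shows "(\<Sum>m\<le>n. f m) = (\<Sum>i\<le>k. f (3 * i + 2))"
proof -
  have "m \<in> (\<lambda>i. 3 * i + 2) ` {..k}" if "m \<le> n" "f m \<noteq> 0" for m
  proof -
    have mod: "m mod 3 = 2"
      by (rule assms(1)[OF that(2)])
    then have "m = 3 * (m div 3) + 2"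
      by presburger
    moreover have "m div 3 \<le> k"
      using mod that(1) assms(2,3) div_mult_mod_eq[of m 3] div_mult_mod_eq[of n 3] by linarith
    ultimately show ?thesis by auto
  qed
  moreover have "(\<lambda>i. 3 * i + 2) ` {..k} \<subseteq> {..n}"
    using assms(2) by auto
  ultimately have "(\<Sum>m\<le>n. f m) = (\<Sum>m\<in>(\<lambda>i. 3 * i + 2) ` {..k}. f m)"
    by (intro sum.mono_neutral_right) auto
  also have "\<dots> = (\<Sum>i\<le>k. f (3 * i + 2))"
    by (subst sum.reindex) (auto simp: inj_on_def)
  finally show ?thesis .
qed

text \<open>Applications of two closed terms give the convolution. Abstractions have a body with one
  free variable, and contracting it gives the factor \<open>6 * real k + 4\<close>, twice the size
  \<open>3 * k + 2\<close>.\<close>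

lemma closed_count_Suc:
  "closed_count (Suc k) = (\<Sum>i\<le>k. closed_count i * closed_count (k - i)) + (6 * real k + 4) * closed_count k"
proof -
  have "closed_count (Suc k) =
      (\<Sum>m\<le>3 * k + 4. lin_count m 0 * lin_count (3 * k + 4 - m) 0) + lin_count (3 * k + 4) 1"
    using lin_count_Suc[of "3 * k + 4" 0] by (simp add: closed_count_def)
  also have "lin_count (3 * k + 4) 1 = (6 * real k + 4) * closed_count k"
  proof -
    have "3 * k + 4 = Suc (Suc (3 * k + 2))"
      by simp
    then show ?thesis
      using lin_count_insert[of "3 * k + 2" 0] by (simp only: closed_count_def One_nat_def) simp
  qed
  also have "(\<Sum>m\<le>3 * k + 4. lin_count m 0 * lin_count (3 * k + 4 - m) 0) =
      (\<Sum>i\<le>k. lin_count (3 * i + 2) 0 * lin_count (3 * k + 4 - (3 * i + 2)) 0)"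
    using lin_count_nonzero_mod3[of _ 0] by (intro sum_mod3_support) auto
  also have "\<dots> = (\<Sum>i\<le>k. closed_count i * closed_count (k - i))"
  proof (intro sum.cong refl)
    fix i assume "i \<in> {..k}"
    then have "3 * k + 4 - (3 * i + 2) = 3 * (k - i) + 2"
      by auto
    then show "lin_count (3 * i + 2) 0 * lin_count (3 * k + 4 - (3 * i + 2)) 0 =
        closed_count i * closed_count (k - i)"
      by (simp only: closed_count_def)
  qed
  finally show ?thesis .
qed

lemma closed_count_pos: "closed_count k > 0"
proof (induction k rule: less_induct)
  case (less k)
  show ?case
  proof (cases k)
    case 0
    then show ?thesis by (simp add: closed_count_0)
  next
    case (Suc j)
    have "(\<Sum>i\<le>j. closed_count i * closed_count (j - i)) \<ge> 0"
      by (intro sum_nonneg) (simp add: closed_count_def)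
    moreover have "(6 * real j + 4) * closed_count j > 0"
      using less Suc by (intro mult_pos_pos) auto
    ultimately show ?thesis
      unfolding Suc closed_count_Suc by linarith
  qed
qed

lemma lin_count_open_Suc:
  "lin_count (3 * Suc k + 2 - Suc s) (Suc s) = 2 * real (3 * k + 2 - s) * lin_count (3 * k + 2 - s) s"
proof (cases "s \<le> 3 * k + 2")
  case True
  then have "3 * Suc k + 2 - Suc s = Suc (Suc (3 * k + 2 - s))"
    by simp
  then show ?thesis
    by (simp only: lin_count_insert)
next
  case False
  \<comment> \<open>Where the subtraction truncates, both sides are 0: a term of size at most 1
    cannot have two or more free variables.\<close>
  then have "3 * Suc k + 2 - Suc s \<le> 1" "3 * k + 2 - s = 0" "s > 0"
    by auto
  then have "3 * Suc k + 2 - Suc s = 0 \<or> 3 * Suc k + 2 - Suc s = Suc 0"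
    by linarith
  with \<open>3 * k + 2 - s = 0\<close> \<open>s > 0\<close> show ?thesis
    by (auto simp only: lin_count_1 id_enum_0) auto
qed

lemma closed_count_growth: "(6 * real k + 4) * closed_count k \<le> closed_count (Suc k)"
  unfolding closed_count_Suc using closed_count_pos by (simp add: sum_nonneg less_imp_le)

text \<open>This bounds every factorial moment by 1. Each contraction contributes a factor of at
  most \<open>6 * real j + 4\<close>, while the closed counts grow by at least that factor.\<close>

lemma lin_count_open_le: "lin_count (3 * k + 2 - s) s \<le> closed_count k"
proof (induction s arbitrary: k)
  case 0
  then show ?case by (simp add: closed_count_def)
next
  case (Suc s)
  show ?case
  proof (cases k)
    case 0
    have "2 - Suc s = 0 \<or> s = 0" by auto
    then show ?thesis
      using 0 by (auto simp: closed_count_0 lin_count_1)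
  next
    case (Suc j)
    have "lin_count (3 * k + 2 - Suc s) (Suc s) =
        2 * real (3 * j + 2 - s) * lin_count (3 * j + 2 - s) s"
      unfolding Suc by (rule lin_count_open_Suc)
    also have "\<dots> \<le> (6 * real j + 4) * closed_count j"
      by (intro mult_mono Suc.IH) auto
    also have "\<dots> \<le> closed_count k"
      unfolding Suc by (rule closed_count_growth)
    finally show ?thesis .
  qed
qed

subsection \<open>Asymptotics\<close>

abbreviation closed_conv :: "nat \<Rightarrow> real" where
  "closed_conv k \<equiv> \<Sum>i\<le>k. closed_count i * closed_count (k - i)"

lemma closed_count_1: "closed_count 1 = 5"
  using closed_count_Suc[of 0] by (simp add: closed_count_0)

lemma closed_count_2: "closed_count 2 = 60"
  using closed_count_Suc[of 1] closed_count_1 by (simp add: closed_count_0 numeral_2_eq_2)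

text \<open>A step towards the middle multiplies one factor by at most
  \<open>6 * real j + 10\<close> and divides the other by at least
  \<open>6 * real (k - Suc j) + 4\<close>, which is no smaller as long as
  \<open>2 * Suc j \<le> k\<close>. The growth bound is a hypothesis because it is established by
  the strong induction that relies on this lemma.\<close>

lemma closed_count_product_antimono:
  assumes growth: "\<And>l. l < k \<Longrightarrow> closed_count (Suc l) \<le> (6 * real l + 10) * closed_count l"
    and "i \<le> j" "2 * j \<le> k"
  shows "closed_count j * closed_count (k - j) \<le> closed_count i * closed_count (k - i)"
  using assms(2,3)
proof (induction j rule: dec_induct)
  case (step j)
  have le: "6 * real j + 10 \<le> 6 * real (k - Suc j) + 4"
    using step.prems by simp
  have "closed_count (Suc j) * closed_count (k - Suc j) \<le>
      (6 * real j + 10) * closed_count j * closed_count (k - Suc j)"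
    using step.prems closed_count_pos[of "k - Suc j"] by (intro mult_right_mono growth) auto
  also have "\<dots> = closed_count j * ((6 * real j + 10) * closed_count (k - Suc j))"
    by simp
  also have "\<dots> \<le> closed_count j * ((6 * real (k - Suc j) + 4) * closed_count (k - Suc j))"
    using le closed_count_pos[of j] closed_count_pos[of "k - Suc j"]
    by (intro mult_left_mono mult_right_mono) auto
  also have "\<dots> \<le> closed_count j * closed_count (Suc (k - Suc j))"
    using closed_count_growth closed_count_pos[of j] by (intro mult_left_mono) auto
  also have "Suc (k - Suc j) = k - j"
    using step.prems by simp
  also have "closed_count j * closed_count (k - j) \<le> closed_count i * closed_count (k - i)"
    using step by simp
  finally show ?case .
qed simp

lemma closed_conv_split:
  assumes "k > 0"
  shows "closed_conv k = 2 * closed_count k + (\<Sum>i\<in>{1..<k}. closed_count i * closed_count (k - i))"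
proof -
  have "{..k} = insert 0 (insert k {1..<k})"
    using assms by auto
  then show ?thesis
    using assms by (simp add: closed_count_0)
qed

text \<open>The two end terms give \<open>10 * closed_count (k - 1)\<close> because
  \<open>closed_count 1 = 5\<close>. The other \<open>k - 3\<close> terms are at most
  \<open>60 * closed_count (k - 2)\<close> each, where \<open>60 = closed_count 2\<close>, and by
  growth their sum is again at most \<open>10 * closed_count (k - 1)\<close>.\<close>

lemma inner_conv_le_if:
  assumes growth: "\<And>l. l < k \<Longrightarrow> closed_count (Suc l) \<le> (6 * real l + 10) * closed_count l"
    and "k \<ge> 3"
  shows "(\<Sum>i\<in>{1..<k}. closed_count i * closed_count (k - i)) \<le> 20 * closed_count (k - 1)"
proof -
  have le: "closed_count i * closed_count (k - i) \<le> 60 * closed_count (k - 2)" if "i \<in> {2..k - 2}" for i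
  proof (cases "2 * i \<le> k")
    case True
    then show ?thesis
      using closed_count_product_antimono[of k 2 i, OF growth] that closed_count_2 by simp
  next
    case False
    then have "2 \<le> k - i" "2 * (k - i) \<le> k" "k - (k - i) = i"
      using that assms(2) by auto
    then show ?thesis
      using closed_count_product_antimono[of k 2 "k - i", OF growth] closed_count_2
      by (simp add: mult.commute)
  qed
  have "{1..<k} = insert 1 (insert (k - 1) {2..k - 2})"
    using assms(2) by auto
  moreover have "1 \<notin> insert (k - 1) {2..k - 2}" "k - 1 \<notin> {2..k - 2}" "k - (k - 1) = 1"
    using assms(2) by auto
  ultimately have "(\<Sum>i\<in>{1..<k}. closed_count i * closed_count (k - i)) =
      10 * closed_count (k - 1) + (\<Sum>i\<in>{2..k - 2}. closed_count i * closed_count (k - i))"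
    using closed_count_1 by simp
  also have "\<dots> \<le> 10 * closed_count (k - 1) + (\<Sum>i\<in>{2..k - 2}. 60 * closed_count (k - 2))"
    by (intro add_left_mono sum_mono le)
  also have "(\<Sum>i\<in>{2..k - 2}. 60 * closed_count (k - 2)) \<le>
      10 * ((6 * real (k - 2) + 4) * closed_count (k - 2))"
    using assms(2) closed_count_pos[of "k - 2"] by (simp add: of_nat_diff algebra_simps)
  also have "(6 * real (k - 2) + 4) * closed_count (k - 2) \<le> closed_count (Suc (k - 2))"
    by (rule closed_count_growth)
  also have "Suc (k - 2) = k - 1"
    using assms(2) by simp
  finally show ?thesis by simp
qed

text \<open>
  The bound for smaller indices makes the ratios \<open>closed_count (Suc l) / closed_count l\<close> increase
  with \<open>l\<close>, so the products in the convolution decrease from its ends to its middle.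
\<close>

lemma closed_conv_le: "closed_conv k \<le> 6 * closed_count k"
proof (induction k rule: less_induct)
  case (less k)
  \<comment> \<open>The constant 6 of the convolution bound raises the factor
    \<open>6 * real l + 4\<close> of the recurrence to \<open>6 * real l + 10\<close>.\<close>
  have growth: "closed_count (Suc l) \<le> (6 * real l + 10) * closed_count l" if "l < k" for l
    using less[OF that] unfolding closed_count_Suc by (simp add: algebra_simps)
  consider "k = 0" | "k = 1" | "k = 2" | "k \<ge> 3" by linarith
  then show ?case
  proof cases
    case 4
    have pred: "Suc (k - 1) = k"
      using 4 by simp
    \<comment> \<open>The end terms use up \<open>2 * closed_count k\<close>, so the inner part, at
      most \<open>20 * closed_count (k - 1)\<close>, has to fit into
      \<open>4 * closed_count k\<close>.\<close>
    have "5 * closed_count (k - 1) \<le> (6 * real (k - 1) + 4) * closed_count (k - 1)"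
      using 4 closed_count_pos[of "k - 1"] by (intro mult_right_mono) auto
    also have "\<dots> \<le> closed_count k"
      using closed_count_growth[of "k - 1"] pred by simp
    finally have "20 * closed_count (k - 1) \<le> 4 * closed_count k"
      by simp
    then show ?thesis
      using closed_conv_split[of k] inner_conv_le_if[OF growth, of k] 4 by simp
  qed (use closed_count_1 closed_count_2 in \<open>simp_all add: closed_count_0 numeral_2_eq_2\<close>)
qed

lemma closed_count_growth_upper: "closed_count (Suc k) \<le> (6 * real k + 10) * closed_count k"
  using closed_conv_le[of k] unfolding closed_count_Suc by (simp add: algebra_simps)

lemma inner_conv_le:
  assumes "k \<ge> 3"
  shows "(\<Sum>i\<in>{1..<k}. closed_count i * closed_count (k - i)) \<le> 20 * closed_count (k - 1)"
  using inner_conv_le_if[OF closed_count_growth_upper assms] .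

lemma inner_conv_tendsto_0:
  "(\<lambda>k. (\<Sum>i\<in>{1..<k}. closed_count i * closed_count (k - i)) / closed_count k) \<longlonglongrightarrow> 0"
proof (rule real_tendsto_sandwich)
  show "\<forall>\<^sub>F k in sequentially. 0 \<le> (\<Sum>i\<in>{1..<k}. closed_count i * closed_count (k - i)) / closed_count k"
    using closed_count_pos by (intro always_eventually allI divide_nonneg_pos sum_nonneg) (auto simp: less_imp_le)
  show "\<forall>\<^sub>F k in sequentially.
      (\<Sum>i\<in>{1..<k}. closed_count i * closed_count (k - i)) / closed_count k \<le> 20 / real k"
    using eventually_ge_at_top[of 3]
  proof eventually_elim
    case (elim k)
    have "(\<Sum>i\<in>{1..<k}. closed_count i * closed_count (k - i)) * real k \<le> 20 * closed_count (k - 1) * real k"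
      using elim by (intro mult_right_mono inner_conv_le) auto
    also have "\<dots> = 20 * (real k * closed_count (k - 1))"
      by simp
    also have "real k * closed_count (k - 1) \<le> (6 * real (k - 1) + 4) * closed_count (k - 1)"
      using elim closed_count_pos[of "k - 1"] by (intro mult_right_mono) auto
    also have "\<dots> \<le> closed_count k"
      using closed_count_growth[of "k - 1"] elim by simp
    finally show ?case
      using elim closed_count_pos[of k] by (simp add: field_simps)
  qed
  show "(\<lambda>k. 20 / real k) \<longlonglongrightarrow> 0"
    by (rule lim_const_over_n)
qed simp

text \<open>Every factorial moment tends to 1: raising \<open>s\<close> and \<open>k\<close> by one
  multiplies the ratio by a contraction factor over \<open>6 * real k + 4\<close> and by
  \<open>q k\<close>, and both tend to 1.\<close>

lemma lin_count_open_ratio_tendsto_1: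
  "(\<lambda>k. lin_count (3 * k + 2 - s) s / closed_count k) \<longlonglongrightarrow> 1"
proof (induction s)
  case 0
  have "closed_count k \<noteq> 0" for k
    using closed_count_pos[of k] by simp
  then show ?case by (simp add: closed_count_def)
next
  case (Suc s)
  \<comment> \<open>The proportion of abstractions among the closed terms of size
    \<open>3 * Suc k + 2\<close>.\<close>
  define q where "q k = (6 * real k + 4) * closed_count k / closed_count (Suc k)" for k
  have q: "q \<longlonglongrightarrow> 1"
  proof (rule real_tendsto_sandwich)
    show "\<forall>\<^sub>F k in sequentially. (6 * real k + 4) / (6 * real k + 10) \<le> q k"
    proof (intro always_eventually allI)
      fix k
      have "(6 * real k + 4) / (6 * real k + 10) =
          (6 * real k + 4) * closed_count k / ((6 * real k + 10) * closed_count k)"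
        using closed_count_pos[of k] by simp
      also have "\<dots> \<le> q k"
        unfolding q_def using closed_count_pos[of k] closed_count_pos[of "Suc k"] closed_count_growth_upper
        by (intro divide_left_mono mult_pos_pos) auto
      finally show "(6 * real k + 4) / (6 * real k + 10) \<le> q k" .
    qed
    show "\<forall>\<^sub>F k in sequentially. q k \<le> 1"
      using closed_count_growth closed_count_pos by (simp add: q_def)
    show "(\<lambda>k. (6 * real k + 4) / (6 * real k + 10)) \<longlonglongrightarrow> 1"
      by real_asymp
  qed simp
  have "(\<lambda>k. (2 * real (3 * k + 2 - s)) / (6 * real k + 4)) \<longlonglongrightarrow> 1"
  proof (rule Lim_transform_eventually)
    show "(\<lambda>k. (6 * real k + 4 - 2 * real s) / (6 * real k + 4)) \<longlonglongrightarrow> 1"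
      by real_asymp
    show "\<forall>\<^sub>F k in sequentially. (6 * real k + 4 - 2 * real s) / (6 * real k + 4) =
        (2 * real (3 * k + 2 - s)) / (6 * real k + 4)"
      using eventually_ge_at_top[of s]
      by eventually_elim (simp add: of_nat_diff algebra_simps)
  qed
  from tendsto_mult[OF tendsto_mult[OF this q] Suc.IH]
  have lim: "(\<lambda>k. 2 * real (3 * k + 2 - s) / (6 * real k + 4) * q k *
      (lin_count (3 * k + 2 - s) s / closed_count k)) \<longlonglongrightarrow> 1"
    by simp
  have eq: "lin_count (3 * Suc k + 2 - Suc s) (Suc s) / closed_count (Suc k) =
      2 * real (3 * k + 2 - s) / (6 * real k + 4) * q k * (lin_count (3 * k + 2 - s) s / closed_count k)" for k
  proof -
    have "closed_count k \<noteq> 0" "6 * real k + 4 \<noteq> 0"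
      using closed_count_pos[of k] by (auto simp: add_nonneg_eq_0_iff)
    then show ?thesis
      unfolding lin_count_open_Suc q_def by simp
  qed
  show ?case
    by (rule LIMSEQ_imp_Suc) (simp only: eq lim)
qed

subsection \<open>Closed subterms other than the identity\<close>

abbreviation is_other :: "tm \<Rightarrow> bool" where
  "is_other t \<equiv> closed_term t \<and> t \<noteq> Lam (Var 0)"

text \<open>The whole term is included, which keeps the recursion uniform; it is discounted only in
  the final comparison.\<close>

definition other_count :: "tm \<Rightarrow> nat" where
  "other_count t = size (filter_mset is_other (subterms t))"

text \<open>The identity is the only closed linear term of size 2.\<close>

definition other_closed :: "nat \<Rightarrow> real" where
  "other_closed n = (if n = 2 then 0 else lin_count n 0)"

text \<open>
  A marked closed subterm of size \<open>j\<close> corresponds to that subterm together with the term of size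
  \<open>n + 1 - j\<close> in which a fresh free variable takes its place.
\<close>

definition other_enum :: "nat \<Rightarrow> nat \<Rightarrow> real" where
  "other_enum n r = (\<Sum>j\<le>n. other_closed j * lin_count (Suc n - j) (Suc r))"

lemma other_enum_0: "other_enum 0 r = 0"
  by (simp add: other_enum_def other_closed_def)

lemma closed_lin_term_iff: "t \<in> lin_terms S n \<Longrightarrow> closed_term t \<longleftrightarrow> S = {}"
  by (auto simp: lin_terms_def closed_term_def free_vars_def)

lemma lin_terms_2_closed: "lin_terms {} 2 = {Lam (Var 0)}"
proof -
  have "card (lin_terms {} 2) = 1"
    using closed_count_0 closed_count_eq_card[of 0] by (simp add: lin_terms_empty_eq numeral_2_eq_2)
  moreover have "Lam (Var 0) \<in> lin_terms {} 2"
    by (simp add: lin_terms_def numeral_2_eq_2)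
  ultimately show ?thesis
    by (metis card_1_singletonE singletonD)
qed

lemma sum_is_other:
  assumes "finite S"
  shows "(\<Sum>t\<in>lin_terms S n. if is_other t then 1 else 0) = (if S = {} then other_closed n else 0)"
proof (cases "S = {}")
  case False
  then show ?thesis
    using closed_lin_term_iff by (auto intro!: sum.neutral)
next
  case True
  show ?thesis
  proof (cases "n = 2")
    case True
    then show ?thesis
      using \<open>S = {}\<close> by (simp add: lin_terms_2_closed other_closed_def)
  next
    case False
    have "is_other t" if "t \<in> lin_terms {} n" for t
      using that False closed_lin_term_iff[OF that] by (auto simp: lin_terms_def)
    then have "(\<Sum>t\<in>lin_terms {} n. if is_other t then 1 else 0) = (\<Sum>t\<in>lin_terms {} n. 1 :: real)"
      by (intro sum.cong) simp_all
    then show ?thesis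
      using True False by (simp add: other_closed_def lin_count_eq_card)
  qed
qed

text \<open>The recurrence of \<open>lin_count\<close> with one distinguished variable, summed
  against \<open>other_closed\<close>. It reflects where the marked subterm lies: it is the whole
  term, or is inside one of two arguments, or inside the body.\<close>

lemma other_enum_Suc:
  "other_enum (Suc n) r = (if r = 0 then other_closed (Suc n) else 0) +
    2 * (\<Sum>m\<le>n. binconv (lin_count m) (other_enum (n - m)) r) + other_enum n (Suc r)"
proof -
  let ?L = lin_count
  \<comment> \<open>The added summands involve size 0 and vanish. The range of \<open>j\<close> no
    longer depends on \<open>m\<close>, so the two sums can be swapped below.\<close>
  have ext: "other_enum (n - m) x = (\<Sum>j\<le>n. other_closed j * ?L (Suc n - j - m) (Suc x))" if "m \<le> n" for m x
  proof -
    have "other_enum (n - m) x = (\<Sum>j\<le>n - m. other_closed j * ?L (Suc n - j - m) (Suc x))"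
      using that unfolding other_enum_def by (intro sum.cong refl) (simp add: Suc_diff_le diff_commute add.commute)
    also have "\<dots> = (\<Sum>j\<le>n. other_closed j * ?L (Suc n - j - m) (Suc x))"
      by (intro sum.mono_neutral_left) auto
    finally show ?thesis .
  qed
  have step: "?L (Suc (Suc n) - j) (Suc r) =
      2 * (\<Sum>m\<le>n. binconv (?L m) (\<lambda>x. ?L (Suc n - j - m) (Suc x)) r) + ?L (Suc n - j) (Suc (Suc r))"
    if "j \<le> n" for j
  proof -
    let ?k = "Suc n - j"
    have "?L (Suc ?k) (Suc r) = (\<Sum>m\<le>?k. binconv (\<lambda>x. ?L m (Suc x)) (?L (?k - m)) r) +
        (\<Sum>m\<le>?k. binconv (?L m) (\<lambda>x. ?L (?k - m) (Suc x)) r) + ?L ?k (Suc (Suc r))"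
      using that unfolding lin_count_Suc[of ?k] by (simp add: sum.distrib Suc_diff_le)
    also have "(\<Sum>m\<le>?k. binconv (\<lambda>x. ?L m (Suc x)) (?L (?k - m)) r) =
        (\<Sum>m\<le>?k. binconv (?L m) (\<lambda>x. ?L (?k - m) (Suc x)) r)"
      by (rule sum_binconv_commute)
    also have "(\<Sum>m\<le>?k. binconv (?L m) (\<lambda>x. ?L (?k - m) (Suc x)) r) =
        (\<Sum>m\<le>Suc n. binconv (?L m) (\<lambda>x. ?L (?k - m) (Suc x)) r)"
    proof (intro sum.mono_neutral_left ballI)
      fix m assume "m \<in> {..Suc n} - {..?k}"
      then have "?k \<le> m"
        by auto
      then have "?k - m = 0"
        by (rule diff_is_0_eq')
      then show "binconv (?L m) (\<lambda>x. ?L (?k - m) (Suc x)) r = 0"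
        by (simp only: id_enum_0 binconv_zero_right)
    qed auto
    also have "\<dots> = (\<Sum>m\<le>n. binconv (?L m) (\<lambda>x. ?L (?k - m) (Suc x)) r)"
      by simp
    finally show ?thesis
      using that by (simp add: Suc_diff_le)
  qed
  \<comment> \<open>At \<open>j = Suc n\<close> the whole term is marked and only the replacing
    variable of size 1 remains, which forces \<open>r = 0\<close>.\<close>
  have "other_enum (Suc n) r = (if r = 0 then other_closed (Suc n) else 0) +
      (\<Sum>j\<le>n. other_closed j * ?L (Suc (Suc n) - j) (Suc r))"
    by (simp add: other_enum_def lin_count_1)
  also have "(\<Sum>j\<le>n. other_closed j * ?L (Suc (Suc n) - j) (Suc r)) =
      (\<Sum>j\<le>n. other_closed j * (2 * (\<Sum>m\<le>n. binconv (?L m) (\<lambda>x. ?L (Suc n - j - m) (Suc x)) r) +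
        ?L (Suc n - j) (Suc (Suc r))))"
    by (intro sum.cong refl) (simp only: step atMost_iff)
  also have "\<dots> = 2 * (\<Sum>j\<le>n. \<Sum>m\<le>n. other_closed j * binconv (?L m) (\<lambda>x. ?L (Suc n - j - m) (Suc x)) r) +
      other_enum n (Suc r)"
    by (simp only: distrib_left sum.distrib other_enum_def sum_distrib_left mult.left_commute)
  also have "(\<Sum>j\<le>n. \<Sum>m\<le>n. other_closed j * binconv (?L m) (\<lambda>x. ?L (Suc n - j - m) (Suc x)) r) =
      (\<Sum>m\<le>n. binconv (?L m) (\<lambda>x. \<Sum>j\<le>n. other_closed j * ?L (Suc n - j - m) (Suc x)) r)"
    by (subst sum.swap) (simp only: binconv_sum_right binconv_cmult_right)
  also have "\<dots> = (\<Sum>m\<le>n. binconv (?L m) (other_enum (n - m)) r)"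
  proof (intro sum.cong refl)
    fix m assume "m \<in> {..n}"
    then have "(\<lambda>x. \<Sum>j\<le>n. other_closed j * ?L (Suc n - j - m) (Suc x)) = other_enum (n - m)"
      using ext by auto
    then show "binconv (?L m) (\<lambda>x. \<Sum>j\<le>n. other_closed j * ?L (Suc n - j - m) (Suc x)) r =
        binconv (?L m) (other_enum (n - m)) r"
      by simp
  qed
  finally show ?thesis by simp
qed

text \<open>No substitution bijection is constructed: the root decomposition gives the left side the
  recurrence \<open>other_enum_Suc\<close>.\<close>

lemma sum_other_count:
  "finite S \<Longrightarrow> (\<Sum>t\<in>lin_terms S n. real (other_count t)) = other_enum n (card S)"
proof (induction n arbitrary: S rule: less_induct)
  case (less n)
  note S = \<open>finite S\<close>
  show ?case
  proof (cases n)
    case 0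
    then show ?thesis by (simp add: other_enum_0)
  next
    case (Suc k)
    let ?L = lin_count
    let ?ind = "\<lambda>t. if is_other t then 1 else 0 :: real"
    \<comment> \<open>Without the root, the count is additive over the immediate subterms;
      \<open>?ind\<close> adds the root back.\<close>
    let ?f = "\<lambda>t. real (other_count t) - ?ind t"
    have IH: "(\<Sum>t\<in>lin_terms A m. real (other_count t)) = other_enum m (card A)"
      if "m \<le> k" "finite A" for A m
      using that Suc less.IH by simp
    have f: "?f (Var i) = 0" "?f (App t u) = real (other_count t) + real (other_count u)"
      "?f (Lam t) = real (other_count t)" for i t u
      by (auto simp: other_count_def closed_term_def free_vars_def)
    have app: "(\<Sum>A\<in>Pow S. \<Sum>t\<in>lin_terms A m. \<Sum>u\<in>lin_terms (S - A) (k - m). ?f (App t u)) =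
        binconv (other_enum m) (?L (k - m)) (card S) + binconv (?L m) (other_enum (k - m)) (card S)"
      if m: "m \<le> k" for m
    proof -
      have "(\<Sum>A\<in>Pow S. \<Sum>t\<in>lin_terms A m. \<Sum>u\<in>lin_terms (S - A) (k - m). ?f (App t u)) =
          (\<Sum>A\<in>Pow S. other_enum m (card A) * ?L (k - m) (card (S - A)) +
            ?L m (card A) * other_enum (k - m) (card (S - A)))"
      proof (intro sum.cong refl)
        fix A assume "A \<in> Pow S"
        then have fin: "finite A" "finite (S - A)"
          using S finite_subset by auto
        have "(\<Sum>t\<in>lin_terms A m. \<Sum>u\<in>lin_terms (S - A) (k - m). ?f (App t u)) =
            (\<Sum>t\<in>lin_terms A m. real (other_count t)) * real (card (lin_terms (S - A) (k - m))) +
            real (card (lin_terms A m)) * (\<Sum>u\<in>lin_terms (S - A) (k - m). real (other_count u))"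
          unfolding f by (simp add: sum.distrib sum_distrib_right mult.commute)
        then show "(\<Sum>t\<in>lin_terms A m. \<Sum>u\<in>lin_terms (S - A) (k - m). ?f (App t u)) =
            other_enum m (card A) * ?L (k - m) (card (S - A)) +
            ?L m (card A) * other_enum (k - m) (card (S - A))"
          using m fin by (simp only: IH card_lin_terms diff_le_self)
      qed
      also have "\<dots> = binconv (other_enum m) (?L (k - m)) (card S) + binconv (?L m) (other_enum (k - m)) (card S)"
        by (simp only: sum.distrib sum_Pow_eq_binconv[OF S])
      finally show ?thesis .
    qed
    have "(\<Sum>t\<in>lin_terms S (Suc k). real (other_count t)) =
        (\<Sum>t\<in>lin_terms S (Suc k). ?f t) + (\<Sum>t\<in>lin_terms S (Suc k). ?ind t)"
      by (simp add: sum_subtractf)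
    also have "(\<Sum>t\<in>lin_terms S (Suc k). ?ind t) = (if card S = 0 then other_closed (Suc k) else 0)"
      using S sum_is_other[OF S] by simp
    also have "(\<Sum>t\<in>lin_terms S (Suc k). ?f t) =
        (\<Sum>m\<le>k. \<Sum>A\<in>Pow S. \<Sum>t\<in>lin_terms A m. \<Sum>u\<in>lin_terms (S - A) (k - m). ?f (App t u)) +
        (\<Sum>t\<in>lin_terms (insert 0 (Suc ` S)) k. real (other_count t))"
      unfolding sum_lin_terms_Suc[OF S] f(1,3) by simp
    also have "(\<Sum>t\<in>lin_terms (insert 0 (Suc ` S)) k. real (other_count t)) = other_enum k (Suc (card S))"
      using S by (simp add: IH card_image)
    also have "(\<Sum>m\<le>k. \<Sum>A\<in>Pow S. \<Sum>t\<in>lin_terms A m. \<Sum>u\<in>lin_terms (S - A) (k - m). ?f (App t u)) =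
        (\<Sum>m\<le>k. binconv (other_enum m) (?L (k - m)) (card S) + binconv (?L m) (other_enum (k - m)) (card S))"
      by (intro sum.cong refl app) simp
    also have "\<dots> = 2 * (\<Sum>m\<le>k. binconv (?L m) (other_enum (k - m)) (card S))"
      by (simp add: sum.distrib sum_binconv_commute[of other_enum])
    finally show ?thesis
      unfolding Suc other_enum_Suc by simp
  qed
qed

text \<open>The whole terms contribute \<open>closed_count (Suc k)\<close>. The index
  \<open>i = 0\<close> drops out because it belongs to the identity, and
  \<open>lin_count_open_le\<close> with one free variable bounds the rest by the inner
  convolution.\<close>

lemma sum_other_count_closed_le:
  "(\<Sum>t\<in>closed_linear_terms (3 * Suc k + 2). real (other_count t)) \<le>
    closed_count (Suc k) + (\<Sum>i\<in>{1..<Suc k}. closed_count i * closed_count (Suc k - i))"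
proof -
  let ?k = "Suc k"
  have "(\<Sum>t\<in>closed_linear_terms (3 * ?k + 2). real (other_count t)) = other_enum (3 * ?k + 2) 0"
    using sum_other_count[of "{}"] by (simp add: lin_terms_empty_eq)
  also have "\<dots> = lin_count (3 * ?k + 2) 0 + (\<Sum>j\<le>3 * ?k + 1. other_closed j * lin_count (3 * ?k + 3 - j) 1)"
  proof -
    have "other_enum (Suc m) 0 = other_closed (Suc m) + (\<Sum>j\<le>m. other_closed j * lin_count (m + 2 - j) 1)" for m
      by (simp add: other_enum_def lin_count_1)
    from this[of "3 * ?k + 1"] show ?thesis
      by (simp add: other_closed_def)
  qed
  also have "(\<Sum>j\<le>3 * ?k + 1. other_closed j * lin_count (3 * ?k + 3 - j) 1) =
      (\<Sum>i\<le>k. other_closed (3 * i + 2) * lin_count (3 * ?k + 3 - (3 * i + 2)) 1)"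
    using lin_count_nonzero_mod3[of _ 0]
    by (intro sum_mod3_support) (auto simp: other_closed_def split: if_splits)
  also have "\<dots> = (\<Sum>i\<in>{1..<?k}. other_closed (3 * i + 2) * lin_count (3 * ?k + 3 - (3 * i + 2)) 1)"
    by (intro sum.mono_neutral_right) (auto simp: other_closed_def)
  also have "\<dots> \<le> (\<Sum>i\<in>{1..<?k}. closed_count i * closed_count (?k - i))"
  proof (intro sum_mono mult_mono)
    fix i assume i: "i \<in> {1..<?k}"
    then have "3 * ?k + 3 - (3 * i + 2) = 3 * (?k - i) + 2 - 1"
      by auto
    then show "lin_count (3 * ?k + 3 - (3 * i + 2)) 1 \<le> closed_count (?k - i)"
      using lin_count_open_le[of "?k - i" 1] by simp
  qed (use closed_count_pos less_imp_le in \<open>auto simp: other_closed_def closed_count_def\<close>)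
  finally show ?thesis
    by (simp add: closed_count_def)
qed

section \<open>Comparison of all closed proper subterms with the identities\<close>

lemma id_count_eq_size: "id_count t = size (filter_mset (\<lambda>s. s = Lam (Var 0)) (subterms t))"
  by (induction t) auto

lemma self_in_subterms: "t \<in># subterms t"
  by (cases t) auto

text \<open>The 1 stands for the whole term, which is not proper but is counted by
  \<open>other_count\<close>, being closed and too large to be the identity.\<close>

lemma closed_proper_subterm_count_eq:
  assumes "t \<in> closed_linear_terms (3 * Suc k + 2)"
  shows "closed_proper_subterm_count t + 1 = id_count t + other_count t" and "other_count t \<ge> 1"
proof -
  have "closed_term t" "t \<noteq> Lam (Var 0)"
    using assms by (auto simp: closed_linear_terms_def)
  then have self: "t \<in># filter_mset closed_term (subterms t)" "t \<in># filter_mset is_other (subterms t)"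
    using self_in_subterms by auto
  have "closed_term (Lam (Var 0))"
    by (simp add: closed_term_def free_vars_def)
  then have "filter_mset closed_term M = filter_mset (\<lambda>s. s = Lam (Var 0)) M + filter_mset is_other M" for M
    by (induction M) auto
  then have "size (filter_mset closed_term (subterms t)) = id_count t + other_count t"
    by (simp add: id_count_eq_size other_count_def)
  moreover have "closed_proper_subterm_count t = size (filter_mset closed_term (subterms t)) - 1"
    using self(1) by (simp add: closed_proper_subterm_count_def proper_subterms_def size_Diff_singleton \<open>closed_term t\<close>)
  moreover have "size (filter_mset closed_term (subterms t)) \<noteq> 0" "size (filter_mset is_other (subterms t)) \<noteq> 0"
    using self by (metis empty_iff set_mset_empty size_eq_0_iff_empty)+
  ultimately show "closed_proper_subterm_count t + 1 = id_count t + other_count t" "other_count t \<ge> 1"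
    unfolding other_count_def by linarith+
qed

lemma sum_count_diff_le:
  "(\<Sum>t\<in>closed_linear_terms (3 * Suc k + 2). real (closed_proper_subterm_count t) - real (id_count t)) \<le>
    (\<Sum>i\<in>{1..<Suc k}. closed_count i * closed_count (Suc k - i))"
proof -
  let ?C = "closed_linear_terms (3 * Suc k + 2)"
  have "(\<Sum>t\<in>?C. real (closed_proper_subterm_count t) - real (id_count t)) = (\<Sum>t\<in>?C. real (other_count t) - 1)"
  proof (intro sum.cong refl)
    fix t assume "t \<in> ?C"
    from closed_proper_subterm_count_eq(1)[OF this]
    show "real (closed_proper_subterm_count t) - real (id_count t) = real (other_count t) - 1"
      by linarith
  qed
  also have "\<dots> = (\<Sum>t\<in>?C. real (other_count t)) - closed_count (Suc k)"
    by (simp add: sum_subtractf closed_count_eq_card)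
  finally show ?thesis
    using sum_other_count_closed_le[of k] by simp
qed

subsection \<open>Convergence of characteristic functions\<close>

lemma iexp_of_nat: "iexp (\<theta> * real m) = iexp \<theta> ^ m"
  by (simp add: exp_of_nat_mult[symmetric] mult_ac)

lemma char_distr_nat:
  "char (distr (measure_pmf p) borel (\<lambda>x. real (f x))) \<theta> = (LINT x|measure_pmf p. iexp \<theta> ^ f x)"
  unfolding char_def by (subst integral_distr) (simp_all only: iexp_of_nat, simp_all)

lemma char_X_sub_law:
  "char (X_sub_law (3 * k + 2)) \<theta> =
    (\<Sum>t\<in>closed_linear_terms (3 * k + 2). iexp \<theta> ^ closed_proper_subterm_count t) / of_real (closed_count k)"
proof -
  let ?C = "closed_linear_terms (3 * k + 2)"
  have C: "finite ?C" "?C \<noteq> {}"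
    by (rule finite_closed_linear_terms, rule closed_linear_terms_nonempty, presburger)
  have "char (X_sub_law (3 * k + 2)) \<theta> =
      (\<Sum>t\<in>?C. pmf (pmf_of_set ?C) t *\<^sub>R iexp \<theta> ^ closed_proper_subterm_count t)"
    unfolding X_sub_law_def char_distr_nat using C by (intro integral_measure_pmf) auto
  also have "\<dots> = (\<Sum>t\<in>?C. iexp \<theta> ^ closed_proper_subterm_count t / of_real (closed_count k))"
    using C by (intro sum.cong) (simp_all add: pmf_of_set closed_count_eq_card scaleR_conv_of_real)
  finally show ?thesis
    by (simp add: sum_divide_distrib)
qed

lemma char_poisson:
  "char (distr (measure_pmf (poisson_pmf 1)) borel real) \<theta> = exp (iexp \<theta> - 1)"
proof -
  define w where "w = iexp \<theta>"
  let ?f = "\<lambda>n. pmf (poisson_pmf 1) n *\<^sub>R w ^ n"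
  have eq: "?f n = of_real (exp (- 1)) * (w ^ n /\<^sub>R fact n)" for n
    by (simp add: scaleR_conv_of_real field_simps)
  have sums: "?f sums (of_real (exp (- 1)) * exp w)"
    unfolding eq by (intro sums_mult exp_converges)
  have "summable (\<lambda>n. norm (?f n))"
    unfolding eq norm_mult by (intro summable_mult summable_norm_exp)
  then have "integrable (count_space UNIV) ?f"
    by (simp add: integrable_count_space_nat_iff)
  then have "?f sums (LINT n|count_space UNIV. ?f n)"
    by (rule sums_integral_count_space_nat)
  then have "(LINT n|count_space UNIV. ?f n) = of_real (exp (- 1)) * exp w"
    using sums sums_unique2 by blast
  moreover have "(LINT n|measure_pmf (poisson_pmf 1). w ^ n) = (LINT n|count_space UNIV. ?f n)"
    unfolding measure_pmf_eq_density by (subst integral_density) simp_all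
  ultimately have "(LINT n|measure_pmf (poisson_pmf 1). w ^ n) = of_real (exp (- 1)) * exp w"
    by simp
  also have "of_real (exp (- 1)) * exp w = exp (w - 1)"
    by (simp add: exp_of_real[symmetric] mult_exp_exp)
  finally show ?thesis
    unfolding w_def using char_distr_nat[of "poisson_pmf 1" "\<lambda>n. n" \<theta>] by simp
qed

lemma of_real_lin_count: "id_enum 1 n r = complex_of_real (lin_count n r)"
  by (simp add: id_enum_def)

lemma id_char_tendsto:
  "(\<lambda>k. (\<Sum>t\<in>closed_linear_terms (3 * k + 2). w ^ id_count t) / of_real (closed_count k))
    \<longlonglongrightarrow> exp (w - 1 :: complex)"
proof -
  define v where "v = w - 1"
  define ratio where "ratio s k = lin_count (3 * k + 2 - s) s / closed_count k" for s k
  define a where "a s k = of_real (ratio s k) * (v ^ s /\<^sub>R fact s)" for s k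
  have ratio: "0 \<le> ratio s k" "ratio s k \<le> 1" for s k
    using lin_count_open_le[of k s] closed_count_pos[of k] by (simp_all add: ratio_def)
  have eq: "(\<Sum>t\<in>closed_linear_terms (3 * k + 2). w ^ id_count t) / of_real (closed_count k) = (\<Sum>s. a s k)" for k
  proof -
    have coeff: "id_enum 1 (3 * k + 2 - s) s / fact s * v ^ s / of_real (closed_count k) = a s k" for s
      by (simp add: a_def ratio_def of_real_lin_count scaleR_conv_of_real field_simps)
    have "(\<Sum>t\<in>closed_linear_terms (3 * k + 2). w ^ id_count t) =
        (\<Sum>s\<le>3 * k + 2. id_enum 1 (3 * k + 2 - s) s / fact s * v ^ s)"
      using sum_id_weight_expand[of v "3 * k + 2"] by (simp add: v_def lin_terms_empty_eq)
    then have "(\<Sum>t\<in>closed_linear_terms (3 * k + 2). w ^ id_count t) / of_real (closed_count k) =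
        (\<Sum>s\<le>3 * k + 2. a s k)"
      by (simp only: sum_divide_distrib coeff)
    \<comment> \<open>For \<open>s > 3 * k + 2\<close> the size truncates to 0, so the coefficient
      is 0.\<close>
    also have "\<dots> = (\<Sum>s. a s k)"
      by (intro suminf_finite[symmetric]) (simp_all add: a_def ratio_def)
    finally show ?thesis .
  qed
  have "(\<lambda>k. \<Sum>s. a s k) \<longlonglongrightarrow> (\<Sum>s. v ^ s /\<^sub>R fact s)"
  proof (intro conjunct2[OF conjunct2[OF tannerys_theorem]])
    show "(\<lambda>k. a s k) \<longlonglongrightarrow> v ^ s /\<^sub>R fact s" for s
    proof -
      have "(\<lambda>k. of_real (ratio s k) * (v ^ s /\<^sub>R fact s)) \<longlonglongrightarrow> of_real 1 * (v ^ s /\<^sub>R fact s)"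
        unfolding ratio_def by (intro tendsto_intros lin_count_open_ratio_tendsto_1)
      then show ?thesis
        unfolding a_def by simp
    qed
    show "\<forall>\<^sub>F (s, k) in sequentially \<times>\<^sub>F sequentially. norm (a s k) \<le> norm (v ^ s /\<^sub>R fact s)"
    proof (intro always_eventually allI, clarify)
      fix s k
      have "norm (a s k) = ratio s k * norm (v ^ s /\<^sub>R fact s)"
        unfolding a_def norm_mult norm_of_real using ratio(1) by simp
      also have "\<dots> \<le> 1 * norm (v ^ s /\<^sub>R fact s)"
        by (intro mult_right_mono ratio) simp
      finally show "norm (a s k) \<le> norm (v ^ s /\<^sub>R fact s)"
        by simp
    qed
    show "summable (\<lambda>s. norm (v ^ s /\<^sub>R fact s))"
      by (rule summable_norm_exp)
  qed simp
  then show ?thesis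
    unfolding eq exp_def v_def .
qed

text \<open>Two powers of \<open>w\<close> differ by at most 2, and not at all if the exponents
  agree. Since \<open>id_count\<close> is the smaller integer exponent, twice the mean excess bounds
  the difference, and the inner convolution controls that mean.\<close>

lemma char_diff_tendsto_0:
  assumes w: "norm w = 1"
  shows "(\<lambda>k. (\<Sum>t\<in>closed_linear_terms (3 * k + 2). w ^ closed_proper_subterm_count t) / of_real (closed_count k) -
      (\<Sum>t\<in>closed_linear_terms (3 * k + 2). w ^ id_count t) / of_real (closed_count k)) \<longlonglongrightarrow> (0 :: complex)"
    (is "?D \<longlonglongrightarrow> 0")
proof (rule LIMSEQ_imp_Suc, rule Lim_null_comparison[OF always_eventually], intro allI)
  let ?q = "\<lambda>k. (\<Sum>i\<in>{1..<k}. closed_count i * closed_count (k - i)) / closed_count k"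
  show "(\<lambda>k. 2 * ?q (Suc k)) \<longlonglongrightarrow> 0"
    using tendsto_mult_right_zero[OF LIMSEQ_Suc[OF inner_conv_tendsto_0]] .
  fix k
  let ?C = "closed_linear_terms (3 * Suc k + 2)"
  have diff: "norm (w ^ closed_proper_subterm_count t - w ^ id_count t) \<le>
      2 * (real (closed_proper_subterm_count t) - real (id_count t))" if "t \<in> ?C" for t
  proof (cases "closed_proper_subterm_count t = id_count t")
    case False
    have ge: "closed_proper_subterm_count t \<ge> id_count t + 1"
      using closed_proper_subterm_count_eq[OF that] False by linarith
    have "norm (w ^ closed_proper_subterm_count t - w ^ id_count t) \<le> 2"
      using norm_triangle_ineq4[of "w ^ closed_proper_subterm_count t" "w ^ id_count t"] w
      by (simp add: norm_power)
    also have "2 \<le> 2 * (real (closed_proper_subterm_count t) - real (id_count t))"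
      using of_nat_mono[OF ge, where 'a = real] by simp
    finally show ?thesis .
  qed simp
  have "?D (Suc k) = (\<Sum>t\<in>?C. w ^ closed_proper_subterm_count t - w ^ id_count t) / of_real (closed_count (Suc k))"
    by (simp add: sum_subtractf diff_divide_distrib)
  then have "norm (?D (Suc k)) = norm (\<Sum>t\<in>?C. w ^ closed_proper_subterm_count t - w ^ id_count t) / closed_count (Suc k)"
    using closed_count_pos[of "Suc k"] by (simp only: norm_divide norm_of_real)
  also have "\<dots> \<le> (\<Sum>t\<in>?C. 2 * (real (closed_proper_subterm_count t) - real (id_count t))) / closed_count (Suc k)"
    using closed_count_pos[of "Suc k"] by (intro divide_right_mono sum_norm_le diff) auto
  also have "\<dots> \<le> 2 * (\<Sum>i\<in>{1..<Suc k}. closed_count i * closed_count (Suc k - i)) / closed_count (Suc k)"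
    unfolding sum_distrib_left[symmetric]
    using closed_count_pos[of "Suc k"] by (intro divide_right_mono mult_left_mono sum_count_diff_le) auto
  finally show "norm (?D (Suc k)) \<le> 2 * ?q (Suc k)"
    by simp
qed

theorem mainTheorem2:
  shows "weak_conv_m (\<lambda>k. X_sub_law (3 * k + 2)) (distr (measure_pmf (poisson_pmf 1)) borel real)"
proof (rule levy_continuity)
  show "real_distribution (X_sub_law (3 * k + 2))" for k
    unfolding X_sub_law_def by (intro prob_space.real_distribution_distr prob_space_measure_pmf) simp
  show "real_distribution (distr (measure_pmf (poisson_pmf 1)) borel real)"
    by (intro prob_space.real_distribution_distr prob_space_measure_pmf) simp
  fix \<theta>
  \<comment> \<open>The characteristic function splits into the part of the identities, with the
    Poisson limit, and a difference that tends to 0.\<close>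
  show "(\<lambda>k. char (X_sub_law (3 * k + 2)) \<theta>) \<longlonglongrightarrow> char (distr (measure_pmf (poisson_pmf 1)) borel real) \<theta>"
    unfolding char_X_sub_law char_poisson
    using tendsto_add[OF char_diff_tendsto_0[of "iexp \<theta>"] id_char_tendsto[of "iexp \<theta>"]] by simp
qed

end
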